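(* Let $k\ge 2$ and let $G=T_n\langle t_1,\ldots,t_k\rangle$ be a Toeplitz graph. If $n>t_{k-1}+t_k$, then the following statements are equivalent: (i) $G$ is claw-free; (ii) $G$ is an interval graph; (iii) $G$ is chordal; (iv) $t_i=it_1$ for each $i\in[k]$; (v) $\omega(G)=k+1$.
   Context: $[m]=\{1,\ldots,m\}$. For integers $1\le t_1<\cdots<t_k<n$, the Toeplitz graph $T_n\langle t_1,\ldots,t_k\rangle$ is the simple graph with vertex set $[n]$ in which $v$ and $w$ are adjacent if and only if $|v-w|=t_i$ for some $i\in[k]$. A claw is an induced subgraph isomorphic to $K_{1,3}$; a graph is claw-free if it has no claw. A graph is chordal if it has no chordless cycle of length at least $4$ as an induced subgraph. A graph is interval if it is the intersection graph of some set of intervals on the real line. $\omega(G)$ is the clique number of $G$ (maximum number of vertices of a clique). *)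

theory Defs
  imports "HOL-Analysis.Analysis" "HOL-Library.Ramsey"
begin

text \<open>
  A simple graph is a pair of a vertex set and a set of two-element subsets of it. This is the
  edge representation on which \<^const>\<open>clique\<close> of \<^theory>\<open>HOL-Library.Ramsey\<close> is based.
\<close>

type_synonym 'a graph = "'a set \<times> 'a set set"

abbreviation verts :: "'a graph \<Rightarrow> 'a set" where "verts \<equiv> fst"
abbreviation edges :: "'a graph \<Rightarrow> 'a set set" where "edges \<equiv> snd"

definition graph_iso :: "'a graph \<Rightarrow> 'b graph \<Rightarrow> bool" where
  "graph_iso G H \<longleftrightarrow>
     (\<exists>f. bij_betw f (verts G) (verts H) \<and>
          (\<forall>u\<in>verts G. \<forall>v\<in>verts G. {u, v} \<in> edges G \<longleftrightarrow> {f u, f v} \<in> edges H))"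

definition induced_subgraph :: "'a graph \<Rightarrow> 'a set \<Rightarrow> 'a graph" where
  "induced_subgraph G S = (S, {e \<in> edges G. e \<subseteq> S})"

definition complete_bipartite :: "nat \<Rightarrow> nat \<Rightarrow> (nat + nat) graph" where
  "complete_bipartite m n = ({..<m} <+> {..<n}, {{Inl i, Inr j} | i j. i < m \<and> j < n})"

text \<open>The following is the cycle of length \<open>m\<close> only for \<open>m \<ge> 3\<close>.\<close>

definition cycle_graph :: "nat \<Rightarrow> nat graph" where
  "cycle_graph m = ({..<m}, {{i, Suc i mod m} | i. i < m})"

definition claw_free :: "'a graph \<Rightarrow> bool" where
  "claw_free G \<longleftrightarrow>
     \<not> (\<exists>S \<subseteq> verts G. graph_iso (induced_subgraph G S) (complete_bipartite 1 3))"

definition chordal :: "'a graph \<Rightarrow> bool" where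
  "chordal G \<longleftrightarrow>
     \<not> (\<exists>S \<subseteq> verts G. \<exists>m \<ge> 4. graph_iso (induced_subgraph G S) (cycle_graph m))"

definition intersection_graph :: "'a set set \<Rightarrow> 'a set graph" where
  "intersection_graph F = (F, {{A, B} | A B. A \<in> F \<and> B \<in> F \<and> A \<noteq> B \<and> A \<inter> B \<noteq> {}})"

text \<open>
  Intervals are nonempty but otherwise arbitrary: open, closed, half-open, bounded or not,
  possibly a single point.
\<close>

definition interval_graph :: "'a graph \<Rightarrow> bool" where
  "interval_graph G \<longleftrightarrow>
     (\<exists>F :: real set set. (\<forall>I\<in>F. is_interval I \<and> I \<noteq> {}) \<and>
        graph_iso G (intersection_graph F))"

text \<open>Meaningful for finite nonempty graphs, since it is a \<^const>\<open>Max\<close>.\<close>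

definition clique_number :: "'a graph \<Rightarrow> nat" where
  "clique_number G = Max {card C | C. C \<subseteq> verts G \<and> clique C (edges G)}"

text \<open>
  The sequence \<open>t\<close> is indexed from \<open>1\<close>; only \<open>t 1, \<dots>, t k\<close> matter. The edges are two-element
  sets provided that these values are positive.
\<close>

definition toeplitz_graph :: "nat \<Rightarrow> nat \<Rightarrow> (nat \<Rightarrow> nat) \<Rightarrow> nat graph" where
  "toeplitz_graph n k t =
     ({1..n}, {{v, w} | v w. v \<in> {1..n} \<and> w \<in> {1..n} \<and>
                 (\<exists>i\<in>{1..k}. \<bar>int v - int w\<bar> = int (t i))})"

end

theory Submission
  imports Defs "HOL-Number_Theory.Cong"
begin

text \<open>
  Let \<open>D = {t 1, \<dots>, t k}\<close> be the set of distances, \<open>d = t 1\<close> the smallest and \<open>T = t k\<close> the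
  largest one. The progression \<open>t i = i * d\<close> is forced as soon as \<open>t j - d \<in> D\<close> for all \<open>j \<ge> 2\<close>:
  inductively, \<open>t j - d\<close> is an earlier distance \<open>l * d\<close>, and \<open>(j - 1) * d < t j\<close> leaves only
  \<open>l = j - 1\<close> (\<open>arithmetic_up_to\<close>). So it suffices that each of the other conditions yields these
  differences.

  A clique with \<open>k + 1\<close> elements and minimum \<open>m\<close> has to be \<open>m\<close> together with all of \<open>m + D\<close>, and
  the edges inside \<open>m + D\<close> are the required differences.

  For claws, \<open>n > t (k - 1) + T\<close> makes \<open>c - t i\<close> (for \<open>i < k\<close>) and \<open>c + t i\<close> (for \<open>i \<le> k\<close>)
  neighbours of \<open>c = t (k - 1) + 1\<close>. As \<open>c + T\<close> is too far from every \<open>c - t i\<close>, the leaves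
  \<open>c - d\<close>, \<open>c - t j\<close>, \<open>c + T\<close> give \<open>t j - d \<in> D\<close> for \<open>j < k\<close>. The leaves
  \<open>c - t (k - 1)\<close>, \<open>c + d\<close>, \<open>c + T\<close> settle \<open>j = k\<close>: either \<open>T - d \<in> D\<close> directly, or
  \<open>t (k - 1) + d \<in> D\<close>, and then it can only be \<open>T\<close>.

  For chordality, the quadrilateral \<open>1, 1 + a, 1 + a + b, 1 + b\<close> shows that distances \<open>a < b\<close>
  satisfy \<open>b - a \<in> D\<close> or \<open>a + b \<in> D\<close>. With \<open>b = T\<close> the second alternative is impossible, so
  \<open>x \<mapsto> T - x\<close> maps the distances below \<open>T\<close> to distances. Now suppose \<open>y - d \<notin> D\<close> for some
  distance \<open>y\<close> between \<open>d\<close> and \<open>T\<close>. The quadrilaterals of \<open>d, y\<close> and of \<open>T - y, T - d\<close> put the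
  sums of both pairs into \<open>D\<close>. Both sums are then at most \<open>T\<close> and they add up to \<open>2 * T\<close>, which
  means \<open>d + y = T\<close>. Consequently \<open>y = T - d\<close> is the second largest distance, and the only
  exception. If it is not \<open>t 2\<close>, then \<open>t 2 - d \<in> D\<close>, that is, \<open>t 2 = 2 * d\<close>, and reflecting
  \<open>t 2\<close> puts \<open>T - 2 * d = y - d\<close> into \<open>D\<close> after all. What remains is
  \<open>D = {a, b, a + b}\<close>, where the quadrilateral condition holds and longer cycles are needed:
  among the vertices \<open>1, \<dots>, a + b\<close> only the distances \<open>a\<close> and \<open>b\<close> occur, and an edge amounts to
  a step by \<open>a\<close> modulo \<open>a + b\<close> in one of the two directions. This graph is a disjoint union of
  cycles of length \<open>(a + b) / gcd a b\<close>, which is at least \<open>4\<close> unless \<open>b = 2 * a\<close>.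

  Conversely, for distances \<open>d, 2 * d, \<dots>, k * d\<close> adjacency means congruence modulo \<open>d\<close> and
  distance at most \<open>k * d\<close>. Two neighbours on the same side of a vertex are then adjacent, which
  excludes claws; and placing the residue classes far apart on the line represents the graph by
  intervals of length \<open>k\<close>. That interval graphs are chordal is a general fact.
\<close>

section \<open>Induced copies of a graph\<close>

text \<open>
  Both forbidden-subgraph conditions become statements about an injection into the vertices of
  \<open>G\<close>, so that claws and chordless cycles can be given by listing their vertices.
\<close>

lemma induced_copy_iff:
  "(\<exists>S \<subseteq> verts G. graph_iso (induced_subgraph G S) H) \<longleftrightarrow>
   (\<exists>g. inj_on g (verts H) \<and> g ` verts H \<subseteq> verts G \<and>
        (\<forall>u\<in>verts H. \<forall>v\<in>verts H. {g u, g v} \<in> edges G \<longleftrightarrow> {u, v} \<in> edges H))"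
  (is "?L \<longleftrightarrow> ?R")
proof
  assume ?L
  then obtain S f where S: "S \<subseteq> verts G" and f: "bij_betw f S (verts H)"
    and e: "\<And>u v. u \<in> S \<Longrightarrow> v \<in> S \<Longrightarrow>
      {u, v} \<in> edges (induced_subgraph G S) \<longleftrightarrow> {f u, f v} \<in> edges H"
    by (auto simp: graph_iso_def induced_subgraph_def)
  define g where "g = inv_into S f"
  have g: "bij_betw g (verts H) S"
    unfolding g_def by (rule bij_betw_inv_into[OF f])
  have fg: "f (g u) = u" if "u \<in> verts H" for u
    unfolding g_def by (rule bij_betw_inv_into_right[OF f that])
  have gS: "g u \<in> S" if "u \<in> verts H" for u
    using g that by (auto simp: bij_betw_def)
  have "{g u, g v} \<in> edges G \<longleftrightarrow> {u, v} \<in> edges H"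
    if "u \<in> verts H" "v \<in> verts H" for u v
    using e[OF gS gS, of u v] that gS by (simp add: fg induced_subgraph_def)
  with g S show ?R
    by (intro exI[of _ g]) (auto simp: bij_betw_def)
next
  assume ?R
  then obtain g where inj: "inj_on g (verts H)" and sub: "g ` verts H \<subseteq> verts G"
    and e: "\<And>u v. u \<in> verts H \<Longrightarrow> v \<in> verts H \<Longrightarrow>
      {g u, g v} \<in> edges G \<longleftrightarrow> {u, v} \<in> edges H"
    by blast
  let ?f = "inv_into (verts H) g"
  have "bij_betw ?f (g ` verts H) (verts H)"
    by (simp add: bij_betw_inv_into inj inj_on_imp_bij_betw)
  then have "graph_iso (induced_subgraph G (g ` verts H)) H"
    using inj e by (auto simp: graph_iso_def induced_subgraph_def intro!: exI[of _ ?f])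
  with sub show ?L by blast
qed

lemma claw_free_iff:
  assumes "\<And>v. {v} \<notin> edges G"
  shows "claw_free G \<longleftrightarrow>
    \<not> (\<exists>c x y z. {c, x, y, z} \<subseteq> verts G \<and> x \<noteq> y \<and> x \<noteq> z \<and> y \<noteq> z \<and>
         {c, x} \<in> edges G \<and> {c, y} \<in> edges G \<and> {c, z} \<in> edges G \<and>
         {x, y} \<notin> edges G \<and> {x, z} \<notin> edges G \<and> {y, z} \<notin> edges G)"
    (is "_ \<longleftrightarrow> \<not> ?C")
proof -
  have V: "verts (complete_bipartite 1 3) = {Inl 0, Inr 0, Inr 1, Inr 2}"
    by (auto simp: complete_bipartite_def)
  have E: "{u, v} \<in> edges (complete_bipartite 1 3) \<longleftrightarrow>
      (u = Inl 0 \<and> v \<in> {Inr 0, Inr 1, Inr 2}) \<or> (v = Inl 0 \<and> u \<in> {Inr 0, Inr 1, Inr 2})"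
    for u v :: "nat + nat"
    by (auto simp: complete_bipartite_def doubleton_eq_iff less_Suc_eq numeral_3_eq_3)
  have "(\<exists>S \<subseteq> verts G. graph_iso (induced_subgraph G S) (complete_bipartite 1 3)) \<longleftrightarrow> ?C"
    unfolding induced_copy_iff
  proof
    assume ?C
    then obtain c x y z where c: "{c, x, y, z} \<subseteq> verts G" "x \<noteq> y" "x \<noteq> z" "y \<noteq> z"
      "{c, x} \<in> edges G" "{c, y} \<in> edges G" "{c, z} \<in> edges G"
      "{x, y} \<notin> edges G" "{x, z} \<notin> edges G" "{y, z} \<notin> edges G"
      by blast
    have "c \<noteq> x" "c \<noteq> y" "c \<noteq> z"
      using c assms by auto
    define g where "g = case_sum (\<lambda>_::nat. c) (\<lambda>i::nat. if i = 0 then x else if i = 1 then y else z)"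
    have g: "g (Inl 0) = c" "g (Inr 0) = x" "g (Inr 1) = y" "g (Inr (Suc 0)) = y" "g (Inr 2) = z"
      by (simp_all add: g_def)
    have "inj_on g (verts (complete_bipartite 1 3))"
      unfolding V using c \<open>c \<noteq> x\<close> \<open>c \<noteq> y\<close> \<open>c \<noteq> z\<close> by (auto simp: g inj_on_def)
    moreover have "{g u, g v} \<in> edges G \<longleftrightarrow> {u, v} \<in> edges (complete_bipartite 1 3)"
      if "u \<in> verts (complete_bipartite 1 3)" "v \<in> verts (complete_bipartite 1 3)" for u v
      using that assms c unfolding V E by (auto simp: g insert_commute)
    ultimately show "\<exists>g. inj_on g (verts (complete_bipartite 1 3)) \<and>
        g ` verts (complete_bipartite 1 3) \<subseteq> verts G \<and>
        (\<forall>u\<in>verts (complete_bipartite 1 3). \<forall>v\<in>verts (complete_bipartite 1 3).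
           {g u, g v} \<in> edges G \<longleftrightarrow> {u, v} \<in> edges (complete_bipartite 1 3))"
      unfolding V using c(1) by (intro exI[of _ g]) (auto simp: g)
  next
    assume "\<exists>g. inj_on g (verts (complete_bipartite 1 3)) \<and>
        g ` verts (complete_bipartite 1 3) \<subseteq> verts G \<and>
        (\<forall>u\<in>verts (complete_bipartite 1 3). \<forall>v\<in>verts (complete_bipartite 1 3).
           {g u, g v} \<in> edges G \<longleftrightarrow> {u, v} \<in> edges (complete_bipartite 1 3))"
    then obtain g where g: "inj_on g {Inl 0, Inr 0, Inr 1, Inr 2} \<and>
        g ` {Inl 0, Inr 0, Inr 1, Inr 2} \<subseteq> verts G \<and>
        (\<forall>u\<in>{Inl 0, Inr 0, Inr 1, Inr 2}. \<forall>v\<in>{Inl 0, Inr 0, Inr 1, Inr 2}.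
           {g u, g v} \<in> edges G \<longleftrightarrow> {u, v} \<in> edges (complete_bipartite 1 3))"
      unfolding V ..
    note inj = conjunct1[OF g] and sub = conjunct1[OF conjunct2[OF g]]
      and e = conjunct2[OF conjunct2[OF g]]
    have spoke: "{g (Inl 0), g (Inr i)} \<in> edges G" if "i \<in> {0, 1, 2}" for i
      using that by (subst e[rule_format]) (auto simp: E simp del: One_nat_def)
    have indep: "{g (Inr i), g (Inr j)} \<notin> edges G" if "i \<in> {0, 1, 2}" "j \<in> {0, 1, 2}" for i j
      using that by (subst e[rule_format]) (auto simp: E simp del: One_nat_def)
    have "g (Inr i) \<noteq> g (Inr j)" if "i \<in> {0, 1, 2}" "j \<in> {0, 1, 2}" "i \<noteq> j" for i j
      using that inj_onD[OF inj, of "Inr i" "Inr j"] by (auto simp del: One_nat_def)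
    then have "g (Inr 0) \<noteq> g (Inr 1)" "g (Inr 0) \<noteq> g (Inr 2)" "g (Inr 1) \<noteq> g (Inr 2)"
      by simp_all
    moreover have "{g (Inl 0), g (Inr 0), g (Inr 1), g (Inr 2)} \<subseteq> verts G"
      using sub by simp
    ultimately show ?C
      using spoke[of 0] spoke[of 1] spoke[of 2] indep[of 0 1] indep[of 0 2] indep[of 1 2]
      by (intro exI[of _ "g (Inl 0)"] exI[of _ "g (Inr 0)"] exI[of _ "g (Inr 1)"]
          exI[of _ "g (Inr 2)"]) simp
  qed
  then show ?thesis by (simp add: claw_free_def)
qed

lemma chordal_iff:
  "chordal G \<longleftrightarrow>
    \<not> (\<exists>m \<ge> 4. \<exists>g. inj_on g {..<m} \<and> g ` {..<m} \<subseteq> verts G \<and>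
         (\<forall>i<m. \<forall>j<m. {g i, g j} \<in> edges G \<longleftrightarrow> j = Suc i mod m \<or> i = Suc j mod m))"
proof -
  have E: "{i, j} \<in> edges (cycle_graph m) \<longleftrightarrow> j = Suc i mod m \<or> i = Suc j mod m"
    if "i < m" "j < m" for i j m
    using that by (auto simp: cycle_graph_def doubleton_eq_iff)
  have V: "verts (cycle_graph m) = {..<m}" for m
    by (simp add: cycle_graph_def)
  have "(\<exists>S \<subseteq> verts G. \<exists>m \<ge> 4. graph_iso (induced_subgraph G S) (cycle_graph m)) \<longleftrightarrow>
    (\<exists>m \<ge> 4. \<exists>S \<subseteq> verts G. graph_iso (induced_subgraph G S) (cycle_graph m))"
    by blast
  also have "\<dots> \<longleftrightarrow> (\<exists>m \<ge> 4. \<exists>g. inj_on g {..<m} \<and> g ` {..<m} \<subseteq> verts G \<and>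
         (\<forall>i<m. \<forall>j<m. {g i, g j} \<in> edges G \<longleftrightarrow> j = Suc i mod m \<or> i = Suc j mod m))"
    unfolding induced_copy_iff V by (simp add: E Ball_def cong: conj_cong)
  finally show ?thesis by (simp add: chordal_def)
qed

section \<open>Interval graphs are chordal\<close>

lemma intersection_graph_edge_iff:
  assumes "A \<in> F" "B \<in> F"
  shows "{A, B} \<in> edges (intersection_graph F) \<longleftrightarrow> A \<noteq> B \<and> A \<inter> B \<noteq> {}"
proof -
  have "{A, B} \<in> edges (intersection_graph F) \<longleftrightarrow>
      (\<exists>A' B'. {A, B} = {A', B'} \<and> A' \<in> F \<and> B' \<in> F \<and> A' \<noteq> B' \<and> A' \<inter> B' \<noteq> {})"
    by (simp add: intersection_graph_def)
  also have "\<dots> \<longleftrightarrow> A \<noteq> B \<and> A \<inter> B \<noteq> {}"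
    unfolding doubleton_eq_iff using assms by (metis Int_commute)
  finally show ?thesis .
qed

text \<open>
  Suppose that the intervals \<open>I i\<close> form a chordless cycle, and pick a point \<open>x i\<close> in the
  intersection of each interval with its successor. Take the largest of these points, with its
  two neighbours on the cycle. The larger of the two neighbouring points lies between two points
  of the interval that contains the other one and the largest point, hence belongs to it; but it
  also belongs to an interval two steps away, which is disjoint from it because the cycle has
  length at least \<open>4\<close>.
\<close>

lemma interval_graph_imp_chordal:
  assumes "interval_graph G"
  shows "chordal G"
  unfolding chordal_iff
proof
  assume "\<exists>m \<ge> 4. \<exists>g. inj_on g {..<m} \<and> g ` {..<m} \<subseteq> verts G \<and>
         (\<forall>i<m. \<forall>j<m. {g i, g j} \<in> edges G \<longleftrightarrow> j = Suc i mod m \<or> i = Suc j mod m)"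
  then obtain m g where m: "m \<ge> 4" and inj: "inj_on g {..<m}" and sub: "g ` {..<m} \<subseteq> verts G"
    and e: "\<And>i j. i < m \<Longrightarrow> j < m \<Longrightarrow>
       {g i, g j} \<in> edges G \<longleftrightarrow> j = Suc i mod m \<or> i = Suc j mod m"
    by blast
  from assms obtain F :: "real set set" where F: "\<And>I. I \<in> F \<Longrightarrow> is_interval I"
    and "graph_iso G (intersection_graph F)"
    unfolding interval_graph_def by blast
  moreover have "verts (intersection_graph F) = F"
    by (simp add: intersection_graph_def)
  ultimately obtain f where f: "bij_betw f (verts G) F"
    and fe: "\<And>u v. u \<in> verts G \<Longrightarrow> v \<in> verts G \<Longrightarrow>
      {u, v} \<in> edges G \<longleftrightarrow> {f u, f v} \<in> edges (intersection_graph F)"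
    unfolding graph_iso_def by auto
  define I where "I i = f (g i)" for i
  have gV: "g i \<in> verts G" if "i < m" for i
    using sub that by auto
  have IF: "I i \<in> F" if "i < m" for i
    using f gV[OF that] by (auto simp: I_def bij_betw_def)
  have I_eq: "I i = I j \<longleftrightarrow> i = j" if "i < m" "j < m" for i j
    using f inj gV that by (auto simp: I_def bij_betw_def inj_on_def)
  have meet: "I i \<inter> I j \<noteq> {} \<longleftrightarrow> j = Suc i mod m \<or> i = Suc j mod m"
    if "i < m" "j < m" "i \<noteq> j" for i j
  proof -
    have "{I i, I j} \<in> edges (intersection_graph F) \<longleftrightarrow> I i \<inter> I j \<noteq> {}"
      using I_eq[OF that(1,2)] that(3)
      by (simp add: intersection_graph_edge_iff IF that)
    then show ?thesis
      using e[OF that(1,2)] fe[OF gV gV, OF that(1,2)] by (simp add: I_def)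
  qed
  have "\<exists>x. x \<in> I i \<inter> I (Suc i mod m)" if "i < m" for i
  proof -
    have "i \<noteq> Suc i mod m" using m that by (auto simp: mod_Suc split: if_splits)
    then show ?thesis using meet[OF that, of "Suc i mod m"] m by auto
  qed
  then obtain x where x: "\<And>i. i < m \<Longrightarrow> x i \<in> I i \<and> x i \<in> I (Suc i mod m)"
    by (metis IntE)
  obtain b where b: "b < m" and bmax: "\<And>i. i < m \<Longrightarrow> x i \<le> x b"
  proof -
    have "Max (x ` {..<m}) \<in> x ` {..<m}"
      using m by (intro Max_in) (auto simp: lessThan_empty_iff)
    then obtain b where "b < m" "Max (x ` {..<m}) = x b" by auto
    then show thesis by (metis Max_ge finite_imageI finite_lessThan imageI lessThan_iff that)
  qed
  \<comment> \<open>\<open>a, b, c, d\<close> are consecutive on the cycle.\<close>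
  define a where "a = (b + m - 1) mod m"
  define c where "c = Suc b mod m"
  define d where "d = Suc c mod m"
  have lt: "a < m" "c < m" "d < m"
    using m by (auto simp: a_def c_def d_def)
  have a': "a = (if b = 0 then m - 1 else b - 1)"
    using b by (auto simp: a_def mod_if)
  have c': "c = (if Suc b = m then 0 else Suc b)"
    using b by (auto simp: c_def mod_Suc)
  have d': "d = (if Suc c = m then 0 else Suc c)"
    using lt(2) by (auto simp: d_def mod_Suc)
  have sa: "Suc a mod m = b"
    using a' b m by (auto simp: mod_Suc)
  have xs: "x a \<in> I a" "x a \<in> I b" "x b \<in> I b" "x b \<in> I c" "x c \<in> I c" "x c \<in> I d"
    using x[OF lt(1)] x[OF b] x[OF lt(2)] unfolding sa c_def[symmetric] d_def[symmetric] by auto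
  have far: "I b \<inter> I d = {}" "I a \<inter> I c = {}"
  proof -
    have "Suc d mod m = (if Suc d = m then 0 else Suc d)"
      using lt(3) by (auto simp: mod_Suc)
    then have "b \<noteq> d" "d \<noteq> c" "b \<noteq> Suc d mod m" "a \<noteq> c" "c \<noteq> b" "a \<noteq> d"
      using a' c' d' m b by (auto split: if_splits)
    then show "I b \<inter> I d = {}" "I a \<inter> I c = {}"
      using meet[OF b lt(3)] meet[OF lt(1,2)]
      unfolding sa c_def[symmetric] d_def[symmetric] by auto
  qed
  show False
  proof (cases "x a \<le> x c")
    case True
    then have "x c \<in> I b"
      by (rule mem_is_interval_1_I[OF F[OF IF[OF b]] xs(2,3) _ bmax[OF lt(2)]])
    with far xs show False by blast
  next
    case False
    then have "x a \<in> I c"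
      by (intro mem_is_interval_1_I[OF F[OF IF[OF lt(2)]] xs(5,4) _ bmax[OF lt(1)]]) simp
    with far xs show False by blast
  qed
qed

section \<open>Distances of a Toeplitz graph\<close>

locale toeplitz =
  fixes n k :: nat and t :: "nat \<Rightarrow> nat"
  assumes k_ge: "k \<ge> 2" and t1_pos: "1 \<le> t 1"
    and t_mono: "strict_mono_on {1..k} t" and tk_less: "t k < n"
begin

definition D :: "nat set" where "D = t ` {1..k}"

abbreviation "G \<equiv> toeplitz_graph n k t"

lemma t_less: "1 \<le> i \<Longrightarrow> i < j \<Longrightarrow> j \<le> k \<Longrightarrow> t i < t j"
  using t_mono by (auto simp: strict_mono_on_def)

lemma t_less_iff: "i \<in> {1..k} \<Longrightarrow> j \<in> {1..k} \<Longrightarrow> t i < t j \<longleftrightarrow> i < j"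
  using strict_mono_on_less[OF t_mono] by blast

lemma t_le_iff: "i \<in> {1..k} \<Longrightarrow> j \<in> {1..k} \<Longrightarrow> t i \<le> t j \<longleftrightarrow> i \<le> j"
  using strict_mono_on_less_eq[OF t_mono] by blast

lemma t_inj: "inj_on t {1..k}"
  using t_mono by (rule strict_mono_on_imp_inj_on)

lemma card_D: "card D = k"
  using card_image[OF t_inj] by (simp add: D_def)

lemma finite_D [simp]: "finite D"
  by (simp add: D_def)

lemma t_in_D: "1 \<le> i \<Longrightarrow> i \<le> k \<Longrightarrow> t i \<in> D"
  by (auto simp: D_def)

lemma D_bounds: "x \<in> D \<Longrightarrow> t 1 \<le> x \<and> 0 < x \<and> x \<le> t k"
proof -
  assume "x \<in> D"
  then obtain i where "i \<in> {1..k}" "x = t i" unfolding D_def by blast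
  then show ?thesis using t_le_iff[of 1 i] t_le_iff[of i k] t1_pos by auto
qed

lemma zero_notin_D: "0 \<notin> D"
  using D_bounds by blast

lemma D_less_tk: "x \<in> D \<Longrightarrow> x < t k \<Longrightarrow> x \<le> t (k - 1)"
  using k_ge by (auto simp: D_def t_less_iff t_le_iff)

lemma verts_G: "verts G = {1..n}"
  by (simp add: toeplitz_graph_def)

text \<open>
  Subtraction is truncated, so at most one of the two differences is nonzero, and \<open>0\<close> is not a
  distance.
\<close>

lemma edge_iff:
  "{v, w} \<in> edges G \<longleftrightarrow> v \<in> {1..n} \<and> w \<in> {1..n} \<and> (w - v \<in> D \<or> v - w \<in> D)"
proof -
  have "(\<exists>i\<in>{1..k}. \<bar>int v - int w\<bar> = int (t i)) \<longleftrightarrow> w - v \<in> D \<or> v - w \<in> D" for v w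
  proof -
    have "\<bar>int v - int w\<bar> = int (t i) \<longleftrightarrow> w - v = t i \<or> v - w = t i" if "i \<in> {1..k}" for i
      using D_bounds[OF t_in_D, of i] that by auto
    then show ?thesis by (auto simp: image_iff D_def)
  qed
  then show ?thesis
    by (auto simp: toeplitz_graph_def doubleton_eq_iff)
qed

lemma no_loop: "{v} \<notin> edges G"
  using edge_iff[of v v] zero_notin_D by simp

lemma edge_add_iff: "v \<in> {1..n} \<Longrightarrow> v + x \<in> {1..n} \<Longrightarrow> {v, v + x} \<in> edges G \<longleftrightarrow> x \<in> D"
  using zero_notin_D by (auto simp: edge_iff)

text \<open>
  Only the differences with the first term are needed. The lemma is stated for an initial segment
  because, for chordal graphs, the beginning of the progression is found before its end.
\<close>

lemma arithmetic_up_to: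
  assumes "m \<le> k" and diff: "\<And>j. 2 \<le> j \<Longrightarrow> j \<le> m \<Longrightarrow> t j - t 1 \<in> D" and "1 \<le> i" "i \<le> m"
  shows "t i = i * t 1"
  using assms(3,4)
proof (induction i rule: less_induct)
  case (less i)
  show ?case
  proof (cases "i = 1")
    case False
    with less.prems have i: "2 \<le> i" "i \<le> k" using assms(1) by auto
    then obtain l where l: "l \<in> {1..k}" "t i - t 1 = t l"
      using diff[of i] less.prems i unfolding D_def by blast
    have ti: "t i = t l + t 1"
      using l t_less[of 1 i] i by auto
    then have "l < i"
      using t_less_iff[of l i] l(1) i t1_pos by auto
    then have tl: "t l = l * t 1" using less.IH[of l] l(1) less.prems by auto
    have "t (i - 1) = (i - 1) * t 1" using less.IH[of "i - 1"] i less.prems by auto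
    moreover have "t (i - 1) < t i" using i t_less[of "i - 1" i] by auto
    ultimately have "(i - 1) * t 1 < (l + 1) * t 1" using ti tl by simp
    then have "i - 1 < l + 1" using mult_less_cancel2 by blast
    with \<open>l < i\<close> have "l + 1 = i" by auto
    with ti tl show ?thesis by auto
  qed auto
qed

abbreviation "arithmetic \<equiv> \<forall>i\<in>{1..k}. t i = i * t 1"

lemma arithmeticI:
  assumes "\<And>j. 2 \<le> j \<Longrightarrow> j \<le> k \<Longrightarrow> t j - t 1 \<in> D"
  shows arithmetic
proof
  fix i assume "i \<in> {1..k}"
  then show "t i = i * t 1" by (intro arithmetic_up_to[OF order.refl assms]) auto
qed

lemma in_D_arithmetic:
  assumes arithmetic
  shows "x \<in> D \<longleftrightarrow> t 1 dvd x \<and> 0 < x \<and> x \<le> k * t 1"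
proof
  assume "x \<in> D"
  then obtain i where "i \<in> {1..k}" "x = t i" unfolding D_def by blast
  with assms have "x = i * t 1" by blast
  with \<open>i \<in> {1..k}\<close> t1_pos show "t 1 dvd x \<and> 0 < x \<and> x \<le> k * t 1" by auto
next
  assume x: "t 1 dvd x \<and> 0 < x \<and> x \<le> k * t 1"
  then obtain i where i: "x = i * t 1" by (metis dvd_def mult.commute)
  with x t1_pos have ik: "i \<in> {1..k}" by auto
  with assms have "t i = i * t 1" by blast
  with i ik show "x \<in> D" using t_in_D[of i] by simp
qed

section \<open>Arithmetic progressions of distances\<close>

text \<open>
  Two neighbours of \<open>c\<close> are congruent modulo \<open>t 1\<close>, and if they lie on the same side of \<open>c\<close>, then
  they are no further apart than the more distant of them is from \<open>c\<close>.
\<close>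

lemma arithmetic_edge_same_side:
  assumes arithmetic and "{c, x} \<in> edges G" and "{c, y} \<in> edges G" and "x \<noteq> y"
    and "c < x \<and> c < y \<or> x < c \<and> y < c"
  shows "{x, y} \<in> edges G"
proof -
  let ?d = "int (t 1)"
  have E: "{v, w} \<in> edges G \<longleftrightarrow> v \<in> {1..n} \<and> w \<in> {1..n} \<and> v \<noteq> w \<and>
      ?d dvd int v - int w \<and> \<bar>int v - int w\<bar> \<le> int (k * t 1)" for v w
  proof (cases v w rule: linorder_cases)
    case less
    then have "int v - int w = - int (w - v)" by auto
    then show ?thesis using less
      by (auto simp: edge_iff in_D_arithmetic[OF assms(1)] zero_notin_D simp del: of_nat_diff of_nat_mult)
  next
    case greater
    then have "int v - int w = int (v - w)" by auto
    then show ?thesis using greater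
      by (auto simp: edge_iff in_D_arithmetic[OF assms(1)] zero_notin_D simp del: of_nat_diff of_nat_mult)
  qed (auto simp: no_loop)
  have "?d dvd int c - int y" "?d dvd int c - int x"
    using assms(2,3) unfolding E by blast+
  then have "?d dvd (int c - int y) - (int c - int x)"
    by (rule dvd_diff)
  then have "?d dvd int x - int y"
    by simp
  moreover have "\<bar>int x - int y\<bar> \<le> int (k * t 1)"
    using assms(2,3,5) unfolding E by linarith
  ultimately show ?thesis
    using assms(2-4) unfolding E by blast
qed

text \<open>Of three neighbours of a vertex, two lie on the same side of it.\<close>

lemma arithmetic_imp_claw_free:
  assumes arithmetic
  shows "claw_free G"
  unfolding claw_free_iff[OF no_loop]
proof (intro notI, elim exE conjE)
  fix c x y z
  assume e: "{c, x} \<in> edges G" "{c, y} \<in> edges G" "{c, z} \<in> edges G"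
    and ne: "x \<noteq> y" "x \<noteq> z" "y \<noteq> z"
    and f: "{x, y} \<notin> edges G" "{x, z} \<notin> edges G" "{y, z} \<notin> edges G"
  have "c \<noteq> x" "c \<noteq> y" "c \<noteq> z"
    using e no_loop by auto
  moreover note arithmetic_edge_same_side[OF assms]
  ultimately show False using e f ne by (metis linorder_neqE_nat)
qed

text \<open>
  Within a residue class modulo \<open>t 1\<close>, vertices are adjacent if and only if their quotients differ
  by at most \<open>k\<close>, that is, if and only if the intervals of length \<open>k\<close> starting at the quotients
  meet. Different classes are shifted apart: quotients are at most \<open>n\<close>, so a shift by
  \<open>n + k + 1\<close> per residue keeps their intervals disjoint. Quotient and residue can be read
  off from the starting point, so distinct vertices get distinct intervals, as the isomorphism
  requires.
\<close>

lemma arithmetic_imp_interval_graph: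
  assumes arithmetic
  shows "interval_graph G"
proof -
  let ?d = "t 1"
  define l where "l v = v div ?d + (v mod ?d) * (n + k + 1)" for v
  define J where "J v = {real (l v)..real (l v + k)}" for v
  have meet: "J u \<inter> J v \<noteq> {} \<longleftrightarrow> l u \<le> l v + k \<and> l v \<le> l u + k" for u v
    by (auto simp: J_def)
  have main: "l u \<le> l v + k \<and> l v \<le> l u + k \<longleftrightarrow> ?d dvd v - u \<and> v - u \<le> k * ?d"
    if uv: "u < v" "v \<le> n" for u v
  proof (cases "u mod ?d = v mod ?d")
    case True
    have dv: "?d dvd v - u" using True uv(1) by (metis mod_eq_dvd_iff_nat less_imp_le)
    then obtain q where q: "v - u = ?d * q" by blast
    then have "v = u + ?d * q" using uv by auto
    then have "v div ?d = u div ?d + q" using t1_pos by simp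
    then show ?thesis using dv True q t1_pos by (auto simp: l_def)
  next
    case False
    then have nd: "\<not> ?d dvd v - u" using uv(1) by (metis mod_eq_dvd_iff_nat less_imp_le)
    have far: "l a + k < l b" if "a mod ?d < b mod ?d" "a \<le> n" for a b
    proof -
      have "(a mod ?d + 1) * (n + k + 1) \<le> (b mod ?d) * (n + k + 1)"
        using that(1) by (intro mult_right_mono) auto
      moreover have "a div ?d \<le> n" using that(2) div_le_dividend le_trans by blast
      ultimately show ?thesis unfolding l_def by (simp add: algebra_simps)
    qed
    from False have "l u + k < l v \<or> l v + k < l u"
      using far[of u v] far[of v u] uv by linarith
    with nd show ?thesis by auto
  qed
  have l_inj: "l u \<noteq> l v" if "u < v" "v \<le> n" for u v
  proof
    assume eq: "l u = l v"
    with main[OF that] have dv: "?d dvd v - u" by auto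
    then have "u mod ?d = v mod ?d" using that(1) by (metis mod_eq_dvd_iff_nat less_imp_le)
    moreover from this eq have "u div ?d = v div ?d" by (simp add: l_def)
    ultimately show False using that(1) by (metis div_mult_mod_eq less_irrefl)
  qed
  have J_eq: "J u = J v \<longleftrightarrow> u = v" if "u \<in> {1..n}" "v \<in> {1..n}" for u v
    using l_inj[of u v] l_inj[of v u] that
    by (cases u v rule: linorder_cases) (auto simp: J_def atLeastatMost_empty_iff Icc_eq_Icc)
  have edge: "{u, v} \<in> edges G \<longleftrightarrow> J u \<inter> J v \<noteq> {}"
    if "u \<in> {1..n}" "v \<in> {1..n}" "u < v" for u v
    using that main[of u v] by (auto simp: edge_iff in_D_arithmetic[OF assms] meet zero_notin_D)
  have edge': "{u, v} \<in> edges G \<longleftrightarrow> J u \<noteq> J v \<and> J u \<inter> J v \<noteq> {}"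
    if "u \<in> {1..n}" "v \<in> {1..n}" for u v
    using edge[of u v] edge[of v u] that J_eq[OF that] no_loop
    by (cases u v rule: linorder_cases) (auto simp: insert_commute Int_commute)
  have "graph_iso G (intersection_graph (J ` {1..n}))"
    unfolding graph_iso_def
  proof (intro exI[of _ J] conjI ballI)
    show "bij_betw J (verts G) (verts (intersection_graph (J ` {1..n})))"
      using J_eq by (auto simp: bij_betw_def inj_on_def verts_G intersection_graph_def)
    fix u v assume "u \<in> verts G" "v \<in> verts G"
    then show "{u, v} \<in> edges G \<longleftrightarrow> {J u, J v} \<in> edges (intersection_graph (J ` {1..n}))"
      unfolding verts_G by (subst edge') (simp_all add: intersection_graph_edge_iff)
  qed
  moreover have "\<forall>I\<in>J ` {1..n}. is_interval I \<and> I \<noteq> {}"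
    by (auto simp: J_def is_interval_cc)
  ultimately show ?thesis
    unfolding interval_graph_def by blast
qed

section \<open>Cliques\<close>

text \<open>
  All elements of a clique are joined to the smallest one, which bounds the size of cliques by
  \<open>k + 1\<close> and determines those that attain it.
\<close>

lemma clique_decomp:
  assumes "C \<subseteq> verts G" "clique C (edges G)" "C \<noteq> {}"
  shows "C \<subseteq> insert (Min C) ((+) (Min C) ` D)"
proof
  fix w assume w: "w \<in> C"
  have fin: "finite C" using assms(1) by (auto simp: verts_G intro: finite_subset)
  show "w \<in> insert (Min C) ((+) (Min C) ` D)"
  proof (cases "w = Min C")
    case False
    have le: "Min C \<le> w" using fin w by simp
    have "{Min C, w} \<in> edges G"
      using assms False fin w Min_in[OF fin assms(3)] by (auto simp: clique_def)
    then have "w - Min C \<in> D" using le zero_notin_D by (auto simp: edge_iff)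
    then have "Min C + (w - Min C) \<in> (+) (Min C) ` D" by blast
    then show ?thesis using le by simp
  qed simp
qed

lemma card_insert_translates: "card (insert m ((+) m ` D)) = k + 1"
proof -
  have "m \<notin> (+) m ` D" using zero_notin_D by auto
  then show ?thesis by (simp add: card_image card_D)
qed

lemma clique_card_le:
  assumes "C \<subseteq> verts G" "clique C (edges G)"
  shows "card C \<le> k + 1"
proof (cases "C = {}")
  case False
  show ?thesis
    using card_mono[OF _ clique_decomp[OF assms False]] card_insert_translates by simp
qed simp

lemma clique_number_eq_iff:
  "clique_number G = k + 1 \<longleftrightarrow> (\<exists>C \<subseteq> verts G. clique C (edges G) \<and> card C = k + 1)"
proof -
  let ?S = "{card C | C. C \<subseteq> verts G \<and> clique C (edges G)}"
  have S: "?S \<subseteq> {..k + 1}" using clique_card_le by auto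
  then have fin: "finite ?S" by (rule finite_subset) simp
  have "card {} \<in> ?S" by (auto simp: clique_def intro!: exI[of _ "{}"])
  then have ne: "?S \<noteq> {}" by blast
  have "Max ?S = k + 1 \<longleftrightarrow> k + 1 \<in> ?S"
    using Max_eq_iff[OF fin ne, of "k + 1"] S by blast
  also have "\<dots> \<longleftrightarrow> (\<exists>C \<subseteq> verts G. clique C (edges G) \<and> card C = k + 1)"
    by (auto simp: eq_commute)
  finally show ?thesis by (simp add: clique_number_def)
qed

lemma arithmetic_iff_clique_number: "arithmetic \<longleftrightarrow> clique_number G = k + 1"
  unfolding clique_number_eq_iff
proof
  assume ar: arithmetic
  let ?C = "insert 1 ((+) 1 ` D)"
  have sub: "?C \<subseteq> verts G"
    using D_bounds tk_less by (force simp: verts_G)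
  have "clique ?C (edges G)"
    unfolding clique_def
  proof (intro ballI impI)
    fix v w assume vw: "v \<in> ?C" "w \<in> ?C" "v \<noteq> w"
    have edge1: "{1, x} \<in> edges G" if "x \<in> ?C" "x \<noteq> 1" for x
    proof -
      obtain y where "y \<in> D" "x = 1 + y" using \<open>x \<in> ?C\<close> \<open>x \<noteq> 1\<close> by auto
      moreover have "x \<in> {1..n}" using sub that(1) unfolding verts_G by blast
      ultimately show ?thesis using edge_add_iff[of 1 y] tk_less by auto
    qed
    consider "v = 1" | "w = 1" | "v \<noteq> 1" "w \<noteq> 1" by blast
    then show "{v, w} \<in> edges G"
    proof cases
      case 3
      then have "1 < v" "1 < w" using vw D_bounds by auto
      then show ?thesis
        using arithmetic_edge_same_side[OF ar edge1 edge1] vw 3 by blast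
    qed (use edge1 vw in \<open>auto simp: insert_commute\<close>)
  qed
  with sub card_insert_translates[of 1]
  show "\<exists>C \<subseteq> verts G. clique C (edges G) \<and> card C = k + 1" by blast
next
  assume "\<exists>C \<subseteq> verts G. clique C (edges G) \<and> card C = k + 1"
  then obtain C where C: "C \<subseteq> verts G" "clique C (edges G)" "card C = k + 1" by blast
  define m where "m = Min C"
  have "C \<noteq> {}" using C(3) by auto
  then have "C \<subseteq> insert m ((+) m ` D)"
    using clique_decomp C unfolding m_def by blast
  then have Ceq: "C = insert m ((+) m ` D)"
    using C(3) card_insert_translates[of m] by (intro card_subset_eq) auto
  show arithmetic
  proof (rule arithmeticI)
    fix j assume j: "2 \<le> j" "j \<le> k"
    have lt: "t 1 < t j" using j t_less[of 1 j] by auto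
    have "m + t 1 \<in> C" "m + t j \<in> C" using j k_ge unfolding Ceq by (auto intro!: t_in_D)
    then have "{m + t 1, m + t j} \<in> edges G"
      using C(2) lt unfolding clique_def by auto
    then show "t j - t 1 \<in> D" using lt zero_notin_D by (auto simp: edge_iff)
  qed
qed

section \<open>Claws and chordless cycles\<close>

text \<open>
  The centre \<open>c\<close> is chosen as far left as possible such that all \<open>c - t i\<close> with \<open>i < k\<close> are still
  vertices; by the bound on \<open>n\<close>, all \<open>c + t i\<close> are vertices as well.
\<close>

lemma claw_free_imp_arithmetic:
  assumes n: "n > t (k - 1) + t k" and cf: "claw_free G"
  shows arithmetic
proof (rule arithmeticI)
  have no_claw: "{x, y} \<in> edges G \<or> {x, z} \<in> edges G \<or> {y, z} \<in> edges G"
    if "{c, x} \<in> edges G" "{c, y} \<in> edges G" "{c, z} \<in> edges G"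
      "x \<noteq> y" "x \<noteq> z" "y \<noteq> z" for c x y z
  proof -
    have "{c, x, y, z} \<subseteq> verts G" using that by (auto simp: edge_iff verts_G)
    then show ?thesis using cf that unfolding claw_free_iff[OF no_loop] by blast
  qed
  define c where "c = t (k - 1) + 1"
  have k1: "k - 1 \<in> {1..k}" using k_ge by auto
  have tk1: "t (k - 1) < t k" using k_ge t_less[of "k - 1" k] by auto
  have right: "{c, c + x} \<in> edges G" if "x \<in> D" for x
    using that n D_bounds[OF that] by (subst edge_add_iff) (auto simp: c_def)
  have left: "{c, c - t i} \<in> edges G" if "1 \<le> i" "i < k" for i
  proof -
    have "t i \<le> t (k - 1)" using that t_le_iff[of i "k - 1"] by auto
    moreover have "t i \<in> D" using that by (intro t_in_D) auto
    ultimately show ?thesis using n by (auto simp: edge_iff c_def)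
  qed
  have top: "{c - t i, c + t k} \<notin> edges G" if "1 \<le> i" "i < k" for i
  proof -
    have "t i \<in> D" using that by (intro t_in_D) auto
    moreover have "t i \<le> t (k - 1)" using that t_le_iff[of i "k - 1"] by auto
    ultimately have "(c + t k) - (c - t i) > t k" "c - t i < c + t k"
      using D_bounds[of "t i"] by (auto simp: c_def)
    then show ?thesis using D_bounds zero_notin_D by (force simp: edge_iff)
  qed
  fix j assume j: "2 \<le> j" "j \<le> k"
  have lt: "t 1 < t j" using j t_less[of 1 j] by auto
  show "t j - t 1 \<in> D"
  proof (cases "j = k")
    case False
    then have tj: "t j \<le> t (k - 1)" using j t_le_iff[of j "k - 1"] by auto
    have ne: "c - t 1 \<noteq> c - t j" "c - t 1 \<noteq> c + t k" "c - t j \<noteq> c + t k"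
      using lt tj t1_pos tk1 by (auto simp: c_def)
    have "1 < k" "1 \<le> j" "j < k" "t k \<in> D"
      using j False k_ge by (auto intro: t_in_D)
    then have "{c - t 1, c - t j} \<in> edges G"
      using no_claw[OF left left right ne, OF order.refl] top[of 1] top[of j] by simp
    moreover have "c - t 1 - (c - t j) = t j - t 1" "c - t j - (c - t 1) = 0"
      using lt tj by (auto simp: c_def)
    ultimately show ?thesis using zero_notin_D by (auto simp: edge_iff)
  next
    case True
    show ?thesis
    proof (rule ccontr)
      assume no: "t j - t 1 \<notin> D"
      have "{c + t 1, c + t k} \<notin> edges G"
        using no lt True zero_notin_D by (auto simp: edge_iff)
      have ne: "c - t (k - 1) \<noteq> c + t 1" "c - t (k - 1) \<noteq> c + t k" "c + t 1 \<noteq> c + t k"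
        using lt True t1_pos by (auto simp: c_def)
      have "1 \<le> k - 1" "k - 1 < k" "t 1 \<in> D" "t k \<in> D"
        using k_ge by (auto intro: t_in_D)
      then have "{c - t (k - 1), c + t 1} \<in> edges G"
        using no_claw[OF left right right ne] top[of "k - 1"]
          \<open>{c + t 1, c + t k} \<notin> edges G\<close> by simp
      then have "t (k - 1) + t 1 \<in> D"
        using zero_notin_D by (auto simp: edge_iff c_def)
      then have "t (k - 1) + t 1 = t k"
        using D_less_tk[of "t (k - 1) + t 1"] D_bounds[of "t (k - 1) + t 1"] t1_pos by force
      with no True k1 show False using t_in_D[of "k - 1"] by (metis True add_diff_cancel_right' atLeastAtMost_iff)
    qed
  qed
qed

text \<open>
  The closed walk with steps \<open>a, b, -a, -b\<close> has diagonals \<open>a + b\<close> and \<open>b - a\<close>, one of which must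
  be a chord.
\<close>

lemma chordal_four_cycle:
  assumes "chordal G" "a \<in> D" "b \<in> D" "a < b" "a + b < n"
  shows "b - a \<in> D \<or> a + b \<in> D"
proof (rule ccontr)
  assume no: "\<not> ?thesis"
  define g where "g i = [1, 1 + a, 1 + a + b, 1 + b] ! i" for i
  have g: "g 0 = 1" "g (Suc 0) = 1 + a" "g 2 = 1 + a + b" "g 3 = 1 + b"
    by (simp_all add: g_def)
  have a0: "0 < a" using D_bounds assms(2) by blast
  have lt4: "{..<4} = {0, Suc 0, 2, 3::nat}" by auto
  have "inj_on g {..<4}"
    unfolding lt4 using a0 assms(4) by (auto simp: g inj_on_def)
  moreover have "g ` {..<4} \<subseteq> verts G"
    unfolding lt4 verts_G using assms(4,5) by (auto simp: g)
  moreover have "{g i, g j} \<in> edges G \<longleftrightarrow> j = Suc i mod 4 \<or> i = Suc j mod 4"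
    if "i < 4" "j < 4" for i j
  proof -
    have "{g 0, g (Suc 0)} \<in> edges G" "{g (Suc 0), g 2} \<in> edges G"
      "{g 2, g 3} \<in> edges G" "{g 3, g 0} \<in> edges G"
      "{g 0, g 2} \<notin> edges G" "{g (Suc 0), g 3} \<notin> edges G"
      using assms(2-5) no zero_notin_D by (auto simp: g edge_iff)
    moreover have "i \<in> {0, Suc 0, 2, 3}" "j \<in> {0, Suc 0, 2, 3}" using that by auto
    moreover have "Suc 0 mod 4 = Suc 0" "Suc (Suc 0) mod 4 = 2" "Suc 2 mod 4 = 3" "Suc 3 mod 4 = 0"
      by simp_all
    ultimately show ?thesis
      by (elim insertE emptyE) (simp_all add: no_loop insert_commute)
  qed
  ultimately show False
    using assms(1) unfolding chordal_iff by blast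
qed

text \<open>
  On the vertices \<open>1, \<dots>, a + b\<close>, going up by \<open>a\<close> or down by \<open>b\<close> is the same as adding \<open>a\<close>
  modulo \<open>c = a + b\<close>, and exactly one of the two stays in the range. The orbit of \<open>1\<close> is thus an
  induced cycle, whose length \<open>m\<close> is the order \<open>c div gcd a c\<close> of \<open>a\<close> modulo \<open>c\<close>. With
  \<open>a = a' * gcd a c\<close> and \<open>a < b\<close>, this \<open>m\<close> is at least \<open>3\<close>, and \<open>m = 3\<close> would mean
  \<open>b = 2 * a\<close>.
\<close>

lemma chordal_two_distances:
  assumes "chordal G" "a \<in> D" "b \<in> D" "a < b" "a + b \<le> n"
    and only: "\<And>x. x \<in> D \<Longrightarrow> x < a + b \<Longrightarrow> x = a \<or> x = b"
  shows "b = 2 * a"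
proof (rule ccontr)
  assume ne: "b \<noteq> 2 * a"
  define c where "c = a + b"
  define q where "q = gcd a c"
  define m where "m = c div q"
  define g where "g i = 1 + (i * a) mod c" for i
  have a0: "0 < a" using D_bounds assms(2) by blast
  have c0: "0 < c" using a0 by (simp add: c_def)
  have q0: "0 < q" using a0 by (simp add: q_def)
  have cm: "c = m * q" by (simp add: m_def q_def)
  obtain a' where a': "a = a' * q" by (metis dvd_def gcd_dvd1 mult.commute q_def)
  have cop: "coprime a' m"
  proof -
    have "a' = a div q" using a' q0 by simp
    then show ?thesis unfolding m_def q_def
      using a0 by (simp add: div_gcd_coprime)
  qed
  \<comment> \<open>Multiples of \<open>a\<close> modulo \<open>c\<close> are counted by their index modulo \<open>m\<close>.\<close>
  have cong_cancel: "[i * a = j * a] (mod c) \<longleftrightarrow> [i = j] (mod m)" for i j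
  proof -
    have "[i * a = j * a] (mod c) \<longleftrightarrow> [(i * a') = (j * a')] (mod m)"
      using q0 unfolding cm a' cong_def by (simp add: mult.assoc[symmetric] mult_mod_left[symmetric])
    also have "\<dots> \<longleftrightarrow> [i = j] (mod m)"
      using cop by (simp add: cong_mult_rcancel_nat)
    finally show ?thesis .
  qed
  have a'0: "0 < a'" using a' a0 by (cases a') auto
  have m4: "4 \<le> m"
  proof -
    have b: "b = (m - a') * q" using cm a' by (simp add: c_def diff_mult_distrib)
    with a' assms(4) q0 have "a' < m - a'" by simp
    moreover have "m - a' \<noteq> 2 * a'" using ne b a' by auto
    ultimately show ?thesis using a'0 by linarith
  qed
  have step: "{g i, g j} \<in> edges G \<longleftrightarrow> [j * a = Suc i * a] (mod c) \<or> [i * a = Suc j * a] (mod c)"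
    for i j
  proof -
    define u where "u = (i * a) mod c"
    define v where "v = (j * a) mod c"
    have uv: "u < c" "v < c" using c0 by (auto simp: u_def v_def)
    have D: "x \<in> D \<longleftrightarrow> x = a \<or> x = b" if "x < c" for x
      using only that assms(2,3) by (auto simp: c_def)
    \<comment> \<open>A step by \<open>a\<close> modulo \<open>c\<close> is a step up by \<open>a\<close> or, if it wraps around, a step down by \<open>b\<close>.\<close>
    have nxt: "[y * a = Suc x * a] (mod c) \<longleftrightarrow>
        (y * a) mod c = (x * a) mod c + a \<or> (y * a) mod c + b = (x * a) mod c" for x y
    proof -
      have wrap: "Y = (X + a) mod c \<longleftrightarrow> Y = X + a \<or> Y + b = X" if "X < c" "Y < c" for X Y
      proof (cases "X + a < c")
        case True
        then show ?thesis using that by (simp add: c_def)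
      next
        case False
        then have "(X + a) mod c = X + a - c"
          using that a0 by (simp add: c_def le_mod_geq)
        then show ?thesis using that False by (auto simp: c_def)
      qed
      have "(Suc x * a) mod c = ((x * a) mod c + a) mod c"
        by (simp add: add.commute mod_add_right_eq)
      then show ?thesis
        using wrap[of "(x * a) mod c" "(y * a) mod c"] c0 by (simp add: cong_def)
    qed
    have "{g i, g j} \<in> edges G \<longleftrightarrow> v - u \<in> D \<or> u - v \<in> D"
      using uv assms(5) by (auto simp: edge_iff g_def u_def v_def c_def)
    also have "\<dots> \<longleftrightarrow> v - u = a \<or> v - u = b \<or> u - v = a \<or> u - v = b"
      using uv D[of "v - u"] D[of "u - v"] by auto
    also have "\<dots> \<longleftrightarrow> (v = u + a \<or> v + b = u) \<or> (u = v + a \<or> u + b = v)"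
      using a0 assms(4) by auto
    finally show ?thesis unfolding nxt u_def v_def .
  qed
  have "inj_on g {..<m}"
    using cong_cancel by (auto simp: inj_on_def g_def cong_def)
  moreover have "g ` {..<m} \<subseteq> verts G"
    using less_le_trans[OF mod_less_divisor[OF c0] assms(5)[folded c_def]]
    by (auto simp: g_def verts_G Suc_le_eq)
  moreover have "{g i, g j} \<in> edges G \<longleftrightarrow> j = Suc i mod m \<or> i = Suc j mod m"
    if "i < m" "j < m" for i j
    unfolding step cong_cancel using that by (simp add: cong_def)
  ultimately show False
    using assms(1) m4 unfolding chordal_iff by blast
qed

text \<open>
  The differences \<open>t j - t 1\<close> come from quadrilaterals, with one exceptional \<open>j\<close> left over; the
  longer cycles are needed only for \<open>k = 3\<close> and distances of the form \<open>a, b, a + b\<close>.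
\<close>

lemma chordal_imp_arithmetic:
  assumes n: "n > t (k - 1) + t k" and ch: "chordal G"
  shows arithmetic
proof (rule arithmeticI)
  have four: "y - x \<in> D \<or> x + y \<in> D" if "x \<in> D" "y \<in> D" "x < y" for x y
  proof -
    have "x < t k" "y \<le> t k" using that D_bounds[of y] by auto
    then have "x + y < n" using D_less_tk[OF that(1)] n by auto
    then show ?thesis using chordal_four_cycle[OF ch that] by blast
  qed
  have tkD: "t k \<in> D" using k_ge by (intro t_in_D) auto
  have reflect: "t k - x \<in> D" if "x \<in> D" "x < t k" for x
    using four[OF that(1) tkD that(2)] D_bounds[of "x + t k"] D_bounds[OF that(1)] by auto
  \<comment> \<open>If \<open>y - t 1\<close> is no distance, then the sums of the pair \<open>t 1, y\<close> and of its mirror image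
    are distances, hence at most \<open>t k\<close>; but they add up to \<open>2 * t k\<close>.\<close>
  have shift: "y - t 1 \<in> D \<or> t 1 + y = t k" if y: "y \<in> D" "t 1 < y" "y < t k" for y
  proof (rule ccontr)
    assume no: "\<not> ?thesis"
    have t1D: "t 1 \<in> D" using k_ge by (intro t_in_D) auto
    have le: "t 1 + y \<le> t k" using four[OF t1D y(1,2)] no D_bounds by blast
    have "(t k - t 1) - (t k - y) = y - t 1" using y by auto
    then have "(t k - y) + (t k - t 1) \<in> D"
      using four[OF reflect[OF y(1)] reflect[OF t1D]] y no by auto
    then have "(t k - y) + (t k - t 1) \<le> t k" using D_bounds by blast
    with le no y show False by auto
  qed
  fix j assume j: "2 \<le> j" "j \<le> k"
  show "t j - t 1 \<in> D"
  proof (rule ccontr)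
    assume no: "t j - t 1 \<notin> D"
    have t1D: "t 1 \<in> D" using k_ge by (intro t_in_D) auto
    have tjD: "t j \<in> D" using j by (intro t_in_D) auto
    have lt: "t 1 < t j" "t 1 < t k" using j t_less[of 1] by auto
    have "j \<noteq> k" using no reflect[OF t1D] lt by auto
    then have jk: "j < k" using j by auto
    have tjk: "t j < t k" using j jk t_less[of j k] by auto
    have sum: "t 1 + t j = t k" using shift[OF tjD lt(1) tjk] no by blast
    have below: "t i \<le> t j" if "1 \<le> i" "i < k" for i
    proof -
      have "t i < t k" using that t_less[of i k] by auto
      then have "t k - t i \<in> D" using that by (intro reflect t_in_D) auto
      then have "t 1 \<le> t k - t i" using D_bounds by blast
      then show ?thesis using sum \<open>t i < t k\<close> by auto
    qed
    have "1 \<le> k - 1" "k - 1 < k" using k_ge by auto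
    then have jk1: "j = k - 1" using below[of "k - 1"] t_le_iff[of "k - 1" j] j jk by auto
    show False
    proof (cases "j = 2")
      case True
      \<comment> \<open>Here \<open>k = 3\<close> and \<open>t 3 = t 1 + t 2\<close>.\<close>
      have "t j = 2 * t 1"
      proof (rule chordal_two_distances[OF ch t1D tjD lt(1)])
        show "t 1 + t j \<le> n" using sum tk_less by simp
        fix x assume "x \<in> D" "x < t 1 + t j"
        then obtain i where "i \<in> {1..k}" "x = t i" "i < k"
          unfolding sum using t_less_iff[of _ k] k_ge by (auto simp: D_def)
        then show "x = t 1 \<or> x = t j" using jk1 True by (cases "i = 1"; cases "i = 2") auto
      qed
      with no t1D show False by simp
    next
      case False
      with j have j3: "3 \<le> j" by auto
      have "t 1 < t 2" "t 2 < t j" using j3 j t_less[of 1 2] t_less[of 2 j] by auto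
      moreover have t2D: "t 2 \<in> D" using k_ge by (intro t_in_D) auto
      ultimately have "t 2 - t 1 \<in> D" using shift[of "t 2"] sum tjk by auto
      then have "t 2 = 2 * t 1"
        using arithmetic_up_to[of 2 2] k_ge by (metis le_antisym one_le_numeral order.refl)
      moreover have "t k - t 2 \<in> D" using t2D \<open>t 2 < t j\<close> tjk by (intro reflect) auto
      ultimately show False using no sum by (simp flip: sum)
    qed
  qed
qed

end

theorem theorem3p5:
  fixes n k :: nat and t :: "nat \<Rightarrow> nat" and G :: "nat graph"
  assumes "k \<ge> 2"
    and "1 \<le> t 1" and "strict_mono_on {1..k} t" and "t k < n"
    and "G = toeplitz_graph n k t"
    and "n > t (k - 1) + t k"
  shows "(claw_free G \<longleftrightarrow> interval_graph G) \<and>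
         (interval_graph G \<longleftrightarrow> chordal G) \<and>
         (chordal G \<longleftrightarrow> (\<forall>i\<in>{1..k}. t i = i * t 1)) \<and>
         ((\<forall>i\<in>{1..k}. t i = i * t 1) \<longleftrightarrow> clique_number G = k + 1)"
proof -
  interpret toeplitz n k t
    using assms(1-4) by unfold_locales
  show ?thesis
    unfolding assms(5)
    using arithmetic_imp_claw_free arithmetic_imp_interval_graph interval_graph_imp_chordal
      claw_free_imp_arithmetic[OF assms(6)] chordal_imp_arithmetic[OF assms(6)]
      arithmetic_iff_clique_number by blast
qed

end
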